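(* Let $(\mathfrak{N},g)$ be an $\mathscr{L}_\varepsilon$-model with universe $N$, and let $\mathfrak{Can\,N}g$ be the canonical model of the theory $\mathrm{Th}(\mathfrak{N},g)$, with universe $\mathrm{Can}\,\mathfrak{N}g$. Then the canonical injection $$\eta:\mathrm{Can}\,\mathfrak{N}g\to N,\qquad \eta\bigl(((\varepsilon v_i)\varphi)^{\mathfrak{Can\,N}g}\bigr)=((\varepsilon v_i)\varphi)^{\mathfrak{N}g}\quad(\varphi\in\mathrm{Fm}_{v_i}(\mathscr{L}_\varepsilon))$$ is an elementary embedding from $\mathfrak{Can\,N}g$ to $(\mathfrak{N},g)$ (with respect to all $\mathscr{L}_\varepsilon$-formulae).
   Context: Epsilon language. $\mathsf{t}=(r_i,f_j,c_k)$ is a similarity type of relation, function and constant symbols. $\mathscr{L}_\varepsilon$ is the language with equality freely generated by $\neg,\vee,\varepsilon$ and $\mathsf{t}$: terms and formulae are defined simultaneously; variables, constants and $f_j(t_1,\dots,t_m)$ are terms, and for every formula $\varphi$ and variable $v_i$, $(\varepsilon v_i)\varphi$ is a term, in which $v_i$ is bound. $(\exists v_i)\varphi$ is $\varphi[(\varepsilon v_i)\varphi/v_i]$ and $(\forall v_i)\varphi$ is $\varphi[(\varepsilon v_i)\neg\varphi/v_i]$. $\mathrm{Fm}_{v_i}(\mathscr{L}_\varepsilon)$ is the set of formulae with no free variable other than $v_i$. Calculus. $\vdash$ is provability in the extensional epsilon calculus: classical propositional logic with equality together with the axiom of transfinity $\varphi[t/v_i]\rightarrow\varphi[(\varepsilon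 v_i)\varphi/v_i]$ and the axiom of extensionality $(\forall v_i)(\varphi\leftrightarrow\psi)\rightarrow(\varepsilon v_i)\varphi=(\varepsilon v_i)\psi$. It is known to be complete with respect to choice structures. Choice structures. A choice function on $M$ is a function $f:\mathrm{Sb}(M)\to M$ on the power set with $f(S)\in S$ for every nonempty $S\subseteq M$ ($f(\emptyset)\in M$ arbitrary). An $\mathscr{L}_\varepsilon$-model (choice structure) is a pair $(\mathfrak{M},f)$ with $\mathfrak{M}$ a first-order $\mathsf{t}$-structure on $M$ and $f$ a choice function on $M$; evaluation is as usual, with $((\varepsilon v_i)\varphi)^{\mathfrak{M}f}[a]=f(\{m\in M\mid(\mathfrak{M},f)\models\varphi[a(v_i\mapsto m)]\})$. $\mathrm{Th}(\mathfrak{M},f)$ is the set of $\mathscr{L}_\varepsilon$-sentences true in $(\mathfrak{M},f)$. Canonical model of a complete consistent theory $\Gamma$. Let $\mathrm{Eps}_1=\{(\varepsilon v_i)\varphi\mid v_i \text{ a variable},\ \varphi\in\mathrm{Fm}_{v_i}(\mathscr{L}_\varepsilon)\}$; $t_1=_\Gamma t_2$ iff $\Gamma\vdash t_1=t_2$; $[t]_\Gamma$ is the class of $t$. The canonical model $(\mathfrak{M},f)$ has universe $M=\mathrm{Eps}_1/\!=_\Gamma$ and interpretations: $([a_1]_\Gamma,\dots,[a_l]_\Gamma)\in r_i^{\mathfrak{M}}$ iff $\Gamma\vdash r_i(a_1,\dots,a_l)$; $f_j^{\mathfrak{M}}([a_1]_\Gamma,\dots,[a_m]_\Gamma)=[(\varepsilon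 v_0)(v_0=f_j(a_1,\dots,a_m))]_\Gamma$; $c_k^{\mathfrak{M}}=[(\varepsilon v_0)(v_0=c_k)]_\Gamma$. Its choice function satisfies $f(\{[t]_\Gamma\in M\mid\Gamma\vdash\varphi[t/v_i]\})=[(\varepsilon v_i)\varphi]_\Gamma$ for $\varphi\in\mathrm{Fm}_{v_i}(\mathscr{L}_\varepsilon)$, and is an arbitrary choice function on all other subsets. In it, $((\varepsilon v_i)\varphi)^{\mathfrak{M}f}=[(\varepsilon v_i)\varphi]_\Gamma$ for $\varphi\in\mathrm{Fm}_{v_i}(\mathscr{L}_\varepsilon)$. Elementary embedding: a (well-defined) injection $\eta$ such that for every $\mathscr{L}_\varepsilon$-formula $\varphi$ and every valuation $a$ in the canonical model, $\mathfrak{Can\,N}g\models\varphi[a]$ iff $(\mathfrak{N},g)\models\varphi[\eta\circ a]$. *)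

theory Defs
  imports Main
begin

section \<open>The epsilon language\<close>

text \<open>
  A similarity type: which elements of the ambient types serve as relation, function and
  constant symbols (each of the three sets may be empty), and the arities.
\<close>

record ('r, 'f, 'c) sim_type =
  rel_syms :: "'r set"
  fun_syms :: "'f set"
  const_syms :: "'c set"
  rel_ar :: "'r \<Rightarrow> nat"
  fun_ar :: "'f \<Rightarrow> nat"

text \<open>Variables are named: \<open>Var i\<close> is $v_i$, and \<open>Eps i \<phi>\<close> is $(\varepsilon v_i)\varphi$.\<close>

datatype ('r, 'f, 'c) trm =
    Var nat
  | Const 'c
  | Fun 'f "('r, 'f, 'c) trm list"
  | Eps nat "('r, 'f, 'c) fm"
and ('r, 'f, 'c) fm =
    Eq "('r, 'f, 'c) trm" "('r, 'f, 'c) trm"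
  | Rel 'r "('r, 'f, 'c) trm list"
  | Neg "('r, 'f, 'c) fm"
  | Or "('r, 'f, 'c) fm" "('r, 'f, 'c) fm"

fun wf_trm :: "('r, 'f, 'c) sim_type \<Rightarrow> ('r, 'f, 'c) trm \<Rightarrow> bool"
  and wf_fm :: "('r, 'f, 'c) sim_type \<Rightarrow> ('r, 'f, 'c) fm \<Rightarrow> bool"
  where
    "wf_trm T (Var i) \<longleftrightarrow> True"
  | "wf_trm T (Const c) \<longleftrightarrow> c \<in> const_syms T"
  | "wf_trm T (Fun h ts) \<longleftrightarrow> h \<in> fun_syms T \<and> length ts = fun_ar T h \<and> (\<forall>t\<in>set ts. wf_trm T t)"
  | "wf_trm T (Eps i \<phi>) \<longleftrightarrow> wf_fm T \<phi>"
  | "wf_fm T (Eq s t) \<longleftrightarrow> wf_trm T s \<and> wf_trm T t"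
  | "wf_fm T (Rel r ts) \<longleftrightarrow> r \<in> rel_syms T \<and> length ts = rel_ar T r \<and> (\<forall>t\<in>set ts. wf_trm T t)"
  | "wf_fm T (Neg \<phi>) \<longleftrightarrow> wf_fm T \<phi>"
  | "wf_fm T (Or \<phi> \<psi>) \<longleftrightarrow> wf_fm T \<phi> \<and> wf_fm T \<psi>"

fun fv_trm :: "('r, 'f, 'c) trm \<Rightarrow> nat set"
  and fv_fm :: "('r, 'f, 'c) fm \<Rightarrow> nat set"
  where
    "fv_trm (Var i) = {i}"
  | "fv_trm (Const c) = {}"
  | "fv_trm (Fun h ts) = (\<Union>t\<in>set ts. fv_trm t)"
  | "fv_trm (Eps i \<phi>) = fv_fm \<phi> - {i}"
  | "fv_fm (Eq s t) = fv_trm s \<union> fv_trm t"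
  | "fv_fm (Rel r ts) = (\<Union>t\<in>set ts. fv_trm t)"
  | "fv_fm (Neg \<phi>) = fv_fm \<phi>"
  | "fv_fm (Or \<phi> \<psi>) = fv_fm \<phi> \<union> fv_fm \<psi>"

text \<open>
  Simultaneous capture-avoiding substitution. A bound variable is renamed only if it would
  capture a variable of a term that is actually substituted under the binder.
\<close>

definition fresh_binder :: "nat \<Rightarrow> nat set \<Rightarrow> nat" where
  "fresh_binder i V = (if i \<notin> V then i else (LEAST j. j \<notin> V))"

primrec subst_trm ::
    "(nat \<Rightarrow> ('r, 'f, 'c) trm) \<Rightarrow> ('r, 'f, 'c) trm \<Rightarrow> ('r, 'f, 'c) trm"
  and subst_fm ::
    "(nat \<Rightarrow> ('r, 'f, 'c) trm) \<Rightarrow> ('r, 'f, 'c) fm \<Rightarrow> ('r, 'f, 'c) fm"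
  where
    "subst_trm \<sigma> (Var i) = \<sigma> i"
  | "subst_trm \<sigma> (Const c) = Const c"
  | "subst_trm \<sigma> (Fun h ts) = Fun h (map (subst_trm \<sigma>) ts)"
  | "subst_trm \<sigma> (Eps i \<phi>) =
      (let j = fresh_binder i (\<Union>k\<in>fv_fm \<phi> - {i}. fv_trm (\<sigma> k))
       in Eps j (subst_fm (\<sigma>(i := Var j)) \<phi>))"
  | "subst_fm \<sigma> (Eq s t) = Eq (subst_trm \<sigma> s) (subst_trm \<sigma> t)"
  | "subst_fm \<sigma> (Rel r ts) = Rel r (map (subst_trm \<sigma>) ts)"
  | "subst_fm \<sigma> (Neg \<phi>) = Neg (subst_fm \<sigma> \<phi>)"
  | "subst_fm \<sigma> (Or \<phi> \<psi>) = Or (subst_fm \<sigma> \<phi>) (subst_fm \<sigma> \<psi>)"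

text \<open>\<open>inst \<phi> i t\<close> is $\varphi[t/v_i]$.\<close>

definition inst :: "('r, 'f, 'c) fm \<Rightarrow> nat \<Rightarrow> ('r, 'f, 'c) trm \<Rightarrow> ('r, 'f, 'c) fm" where
  "inst \<phi> i t = subst_fm (Var(i := t)) \<phi>"

definition Imp :: "('r, 'f, 'c) fm \<Rightarrow> ('r, 'f, 'c) fm \<Rightarrow> ('r, 'f, 'c) fm" where
  "Imp \<phi> \<psi> = Or (Neg \<phi>) \<psi>"

definition And :: "('r, 'f, 'c) fm \<Rightarrow> ('r, 'f, 'c) fm \<Rightarrow> ('r, 'f, 'c) fm" where
  "And \<phi> \<psi> = Neg (Or (Neg \<phi>) (Neg \<psi>))"

definition Iff :: "('r, 'f, 'c) fm \<Rightarrow> ('r, 'f, 'c) fm \<Rightarrow> ('r, 'f, 'c) fm" where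
  "Iff \<phi> \<psi> = And (Imp \<phi> \<psi>) (Imp \<psi> \<phi>)"

definition Forall :: "nat \<Rightarrow> ('r, 'f, 'c) fm \<Rightarrow> ('r, 'f, 'c) fm" where
  "Forall i \<phi> = inst \<phi> i (Eps i (Neg \<phi>))"

text \<open>\<open>Fm T i\<close>: the formulae with no free variable other than $v_i$.\<close>

definition Fm :: "('r, 'f, 'c) sim_type \<Rightarrow> nat \<Rightarrow> ('r, 'f, 'c) fm set" where
  "Fm T i = {\<phi>. wf_fm T \<phi> \<and> fv_fm \<phi> \<subseteq> {i}}"

definition sentences :: "('r, 'f, 'c) sim_type \<Rightarrow> ('r, 'f, 'c) fm set" where
  "sentences T = {\<phi>. wf_fm T \<phi> \<and> fv_fm \<phi> = {}}"


section \<open>The extensional epsilon calculus\<close>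

text \<open>
  Classical propositional logic is given by all tautological instances, where equations and
  relational formulae are the atoms. There is no generalisation rule, as the quantifiers are
  defined by epsilon terms.
\<close>

definition tautology :: "('r, 'f, 'c) fm \<Rightarrow> bool" where
  "tautology \<phi> \<longleftrightarrow>
    (\<forall>v :: ('r, 'f, 'c) fm \<Rightarrow> bool.
      (\<forall>\<psi>. v (Neg \<psi>) \<longleftrightarrow> \<not> v \<psi>) \<and> (\<forall>\<psi> \<chi>. v (Or \<psi> \<chi>) \<longleftrightarrow> v \<psi> \<or> v \<chi>) \<longrightarrow> v \<phi>)"

inductive provable ::
    "('r, 'f, 'c) sim_type \<Rightarrow> ('r, 'f, 'c) fm set \<Rightarrow> ('r, 'f, 'c) fm \<Rightarrow> bool"
  for T :: "('r, 'f, 'c) sim_type" and \<Gamma> :: "('r, 'f, 'c) fm set"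
  where
    assm: "\<phi> \<in> \<Gamma> \<Longrightarrow> provable T \<Gamma> \<phi>"
  | taut: "wf_fm T \<phi> \<Longrightarrow> tautology \<phi> \<Longrightarrow> provable T \<Gamma> \<phi>"
  | eq_refl: "wf_trm T t \<Longrightarrow> provable T \<Gamma> (Eq t t)"
  | eq_subst: "wf_fm T \<phi> \<Longrightarrow> wf_trm T s \<Longrightarrow> wf_trm T t \<Longrightarrow>
      provable T \<Gamma> (Imp (Eq s t) (Imp (inst \<phi> i s) (inst \<phi> i t)))"
  | transfinity: "wf_fm T \<phi> \<Longrightarrow> wf_trm T t \<Longrightarrow>
      provable T \<Gamma> (Imp (inst \<phi> i t) (inst \<phi> i (Eps i \<phi>)))"
  | extensionality: "wf_fm T \<phi> \<Longrightarrow> wf_fm T \<psi> \<Longrightarrow>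
      provable T \<Gamma> (Imp (Forall i (Iff \<phi> \<psi>)) (Eq (Eps i \<phi>) (Eps i \<psi>)))"
  | mp: "provable T \<Gamma> (Imp \<phi> \<psi>) \<Longrightarrow> provable T \<Gamma> \<phi> \<Longrightarrow> provable T \<Gamma> \<psi>"


section \<open>Choice structures\<close>

record ('r, 'f, 'c, 'm) fo_struct =
  univ :: "'m set"
  rel_int :: "'r \<Rightarrow> 'm list set"
  fun_int :: "'f \<Rightarrow> 'm list \<Rightarrow> 'm"
  const_int :: "'c \<Rightarrow> 'm"

definition is_fo_struct :: "('r, 'f, 'c) sim_type \<Rightarrow> ('r, 'f, 'c, 'm) fo_struct \<Rightarrow> bool" where
  "is_fo_struct T M \<longleftrightarrow>
    univ M \<noteq> {} \<and>
    (\<forall>r\<in>rel_syms T. rel_int M r \<subseteq> {xs. length xs = rel_ar T r \<and> set xs \<subseteq> univ M}) \<and>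
    (\<forall>h\<in>fun_syms T. \<forall>xs. length xs = fun_ar T h \<and> set xs \<subseteq> univ M \<longrightarrow> fun_int M h xs \<in> univ M) \<and>
    (\<forall>c\<in>const_syms T. const_int M c \<in> univ M)"

definition choice_function :: "'m set \<Rightarrow> ('m set \<Rightarrow> 'm) \<Rightarrow> bool" where
  "choice_function M f \<longleftrightarrow> (\<forall>S\<subseteq>M. f S \<in> M \<and> (S \<noteq> {} \<longrightarrow> f S \<in> S))"

definition choice_structure ::
    "('r, 'f, 'c) sim_type \<Rightarrow> ('r, 'f, 'c, 'm) fo_struct \<Rightarrow> ('m set \<Rightarrow> 'm) \<Rightarrow> bool" where
  "choice_structure T M f \<longleftrightarrow> is_fo_struct T M \<and> choice_function (univ M) f"

definition valuation :: "('r, 'f, 'c, 'm) fo_struct \<Rightarrow> (nat \<Rightarrow> 'm) \<Rightarrow> bool" where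
  "valuation M a \<longleftrightarrow> (\<forall>i. a i \<in> univ M)"

primrec eval ::
    "('r, 'f, 'c, 'm) fo_struct \<Rightarrow> ('m set \<Rightarrow> 'm) \<Rightarrow> (nat \<Rightarrow> 'm) \<Rightarrow> ('r, 'f, 'c) trm \<Rightarrow> 'm"
  and sat ::
    "('r, 'f, 'c, 'm) fo_struct \<Rightarrow> ('m set \<Rightarrow> 'm) \<Rightarrow> (nat \<Rightarrow> 'm) \<Rightarrow> ('r, 'f, 'c) fm \<Rightarrow> bool"
  where
    "eval M f a (Var i) = a i"
  | "eval M f a (Const c) = const_int M c"
  | "eval M f a (Fun h ts) = fun_int M h (map (eval M f a) ts)"
  | "eval M f a (Eps i \<phi>) = f {m \<in> univ M. sat M f (a(i := m)) \<phi>}"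
  | "sat M f a (Eq s t) \<longleftrightarrow> eval M f a s = eval M f a t"
  | "sat M f a (Rel r ts) \<longleftrightarrow> map (eval M f a) ts \<in> rel_int M r"
  | "sat M f a (Neg \<phi>) \<longleftrightarrow> \<not> sat M f a \<phi>"
  | "sat M f a (Or \<phi> \<psi>) \<longleftrightarrow> sat M f a \<phi> \<or> sat M f a \<psi>"

text \<open>The value of a closed term, which does not depend on the valuation.\<close>

definition closed_val ::
    "('r, 'f, 'c, 'm) fo_struct \<Rightarrow> ('m set \<Rightarrow> 'm) \<Rightarrow> ('r, 'f, 'c) trm \<Rightarrow> 'm" where
  "closed_val M f t = (THE m. \<forall>a. valuation M a \<longrightarrow> eval M f a t = m)"

definition Th ::
    "('r, 'f, 'c) sim_type \<Rightarrow> ('r, 'f, 'c, 'm) fo_struct \<Rightarrow> ('m set \<Rightarrow> 'm) \<Rightarrow> ('r, 'f, 'c) fm set"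
  where
  "Th T M f = {\<phi> \<in> sentences T. \<forall>a. valuation M a \<longrightarrow> sat M f a \<phi>}"


section \<open>Canonical models\<close>

definition Eps1 :: "('r, 'f, 'c) sim_type \<Rightarrow> ('r, 'f, 'c) trm set" where
  "Eps1 T = {Eps i \<phi> | i \<phi>. \<phi> \<in> Fm T i}"

definition prov_eq ::
    "('r, 'f, 'c) sim_type \<Rightarrow> ('r, 'f, 'c) fm set \<Rightarrow> ('r, 'f, 'c) trm rel" where
  "prov_eq T \<Gamma> = {(s, t). s \<in> Eps1 T \<and> t \<in> Eps1 T \<and> provable T \<Gamma> (Eq s t)}"

definition cls ::
    "('r, 'f, 'c) sim_type \<Rightarrow> ('r, 'f, 'c) fm set \<Rightarrow> ('r, 'f, 'c) trm \<Rightarrow> ('r, 'f, 'c) trm set" where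
  "cls T \<Gamma> t = prov_eq T \<Gamma> `` {t}"

text \<open>
  The canonical model of \<open>\<Gamma>\<close> is unique only up to the values of the choice function on the
  sets that are not of the form displayed in the last clause, so it is given by a predicate.
\<close>

definition canonical_model ::
    "('r, 'f, 'c) sim_type \<Rightarrow> ('r, 'f, 'c) fm set \<Rightarrow>
     ('r, 'f, 'c, ('r, 'f, 'c) trm set) fo_struct \<Rightarrow>
     (('r, 'f, 'c) trm set set \<Rightarrow> ('r, 'f, 'c) trm set) \<Rightarrow> bool" where
  "canonical_model T \<Gamma> M f \<longleftrightarrow>
    choice_structure T M f \<and>
    univ M = Eps1 T // prov_eq T \<Gamma> \<and>
    (\<forall>r\<in>rel_syms T. \<forall>as. length as = rel_ar T r \<and> set as \<subseteq> Eps1 T \<longrightarrow>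
      (map (cls T \<Gamma>) as \<in> rel_int M r \<longleftrightarrow> provable T \<Gamma> (Rel r as))) \<and>
    (\<forall>h\<in>fun_syms T. \<forall>as. length as = fun_ar T h \<and> set as \<subseteq> Eps1 T \<longrightarrow>
      fun_int M h (map (cls T \<Gamma>) as) = cls T \<Gamma> (Eps 0 (Eq (Var 0) (Fun h as)))) \<and>
    (\<forall>c\<in>const_syms T. const_int M c = cls T \<Gamma> (Eps 0 (Eq (Var 0) (Const c)))) \<and>
    (\<forall>i. \<forall>\<phi>\<in>Fm T i.
      f {cls T \<Gamma> t | t. t \<in> Eps1 T \<and> provable T \<Gamma> (inst \<phi> i t)} = cls T \<Gamma> (Eps i \<phi>))"


section \<open>Elementary embeddings\<close>

definition elementary_embedding ::
    "('r, 'f, 'c) sim_type \<Rightarrow> ('r, 'f, 'c, 'm) fo_struct \<Rightarrow> ('m set \<Rightarrow> 'm) \<Rightarrow>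
     ('r, 'f, 'c, 'n) fo_struct \<Rightarrow> ('n set \<Rightarrow> 'n) \<Rightarrow> ('m \<Rightarrow> 'n) \<Rightarrow> bool" where
  "elementary_embedding T M f N g \<eta> \<longleftrightarrow>
    \<eta> ` univ M \<subseteq> univ N \<and> inj_on \<eta> (univ M) \<and>
    (\<forall>\<phi> a. wf_fm T \<phi> \<and> valuation M a \<longrightarrow> (sat M f a \<phi> \<longleftrightarrow> sat N g (\<eta> \<circ> a) \<phi>))"

definition canonical_injection ::
    "('r, 'f, 'c) sim_type \<Rightarrow> ('r, 'f, 'c, 'm) fo_struct \<Rightarrow> ('m set \<Rightarrow> 'm) \<Rightarrow>
     ('r, 'f, 'c, 'n) fo_struct \<Rightarrow> ('n set \<Rightarrow> 'n) \<Rightarrow> 'm \<Rightarrow> 'n" where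
  "canonical_injection T M f N g x =
    (THE y. \<exists>i. \<exists>\<phi>\<in>Fm T i. x = closed_val M f (Eps i \<phi>) \<and> y = closed_val N g (Eps i \<phi>))"


section \<open>Existence of the canonical model of the theory of a choice structure\<close>

text \<open>
  The functions and the choice function of a canonical model are constrained on
  representatives; the following shows that these constraints are consistent.
\<close>

lemma fv_finite: "finite (fv_trm t)" "finite (fv_fm \<phi>)" for t :: "('r,'f,'c) trm" and \<phi> :: "('r,'f,'c) fm"
  by (induction t and \<phi>) auto

lemma fresh_binder_notin: "finite V \<Longrightarrow> fresh_binder i V \<notin> V"
proof -
  assume "finite V"
  then obtain j where "j \<notin> V" using ex_new_if_finite infinite_UNIV_nat by blast
  then show ?thesis unfolding fresh_binder_def using LeastI[of "\<lambda>j. j \<notin> V" j] by auto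
qed

lemma coincidence:
  fixes t :: "('r,'f,'c) trm" and \<phi> :: "('r,'f,'c) fm"
  shows "(\<forall>i\<in>fv_trm t. a i = b i) \<Longrightarrow> eval M f a t = eval M f b t"
   "(\<forall>i\<in>fv_fm \<phi>. a i = b i) \<Longrightarrow> sat M f a \<phi> = sat M f b \<phi>"
proof (induction t and \<phi> arbitrary: a b and a b)
  case (Fun h ts)
  then have "map (eval M f a) ts = map (eval M f b) ts" by auto
  then show ?case by (simp del: map_eq_conv)
next
  case (Rel h ts)
  then have "map (eval M f a) ts = map (eval M f b) ts" by auto
  then show ?case by (simp del: map_eq_conv)
next
  case (Eps i \<phi>)
  have "sat M f (a(i:=m)) \<phi> = sat M f (b(i:=m)) \<phi>" for m
    by (rule Eps.IH) (use Eps.prems in auto)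
  then show ?case by simp
next
  case (Eq s t)
  have "eval M f a s = eval M f b s" "eval M f a t = eval M f b t"
    by (rule Eq.IH; use Eq.prems in simp)+
  then show ?case by simp
next
  case (Neg \<phi>) then show ?case by (metis fv_fm.simps(3) sat.simps(3))
next
  case (Or \<phi> \<psi>)
  have "sat M f a \<phi> = sat M f b \<phi>" "sat M f a \<psi> = sat M f b \<psi>"
    by (rule Or.IH; use Or.prems in simp)+
  then show ?case by simp
qed simp_all

lemma substitution:
  fixes t :: "('r,'f,'c) trm" and \<phi> :: "('r,'f,'c) fm"
  shows "eval M f a (subst_trm \<sigma> t) = eval M f (\<lambda>k. eval M f a (\<sigma> k)) t"
   "sat M f a (subst_fm \<sigma> \<phi>) = sat M f (\<lambda>k. eval M f a (\<sigma> k)) \<phi>"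
proof (induction t and \<phi> arbitrary: a \<sigma> and a \<sigma>)
  case (Fun h ts)
  then have "map (eval M f a \<circ> subst_trm \<sigma>) ts = map (eval M f (\<lambda>k. eval M f a (\<sigma> k))) ts" by auto
  then show ?case by (simp del: map_eq_conv)
next
  case (Rel h ts)
  then have "map (eval M f a \<circ> subst_trm \<sigma>) ts = map (eval M f (\<lambda>k. eval M f a (\<sigma> k))) ts" by auto
  then show ?case by (simp del: map_eq_conv)
next
  case (Eps i \<phi>)
  define V where "V = (\<Union>k\<in>fv_fm \<phi> - {i}. fv_trm (\<sigma> k))"
  define j where "j = fresh_binder i V"
  have jV: "j \<notin> V" unfolding j_def by (rule fresh_binder_notin) (simp add: V_def fv_finite)
  have "sat M f (a(j := m)) (subst_fm (\<sigma>(i := Var j)) \<phi>) = sat M f ((\<lambda>k. eval M f a (\<sigma> k))(i := m)) \<phi>" for m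
    unfolding Eps.IH
  proof (rule coincidence(2), rule ballI)
    fix k assume k: "k \<in> fv_fm \<phi>"
    show "eval M f (a(j := m)) ((\<sigma>(i := Var j)) k) = ((\<lambda>k. eval M f a (\<sigma> k))(i := m)) k"
    proof (cases "k = i")
      case False
      then have "j \<notin> fv_trm (\<sigma> k)" using jV k unfolding V_def by auto
      then have "eval M f (a(j := m)) (\<sigma> k) = eval M f a (\<sigma> k)" by (intro coincidence(1)) auto
      then show ?thesis using False by simp
    qed simp
  qed
  then show ?case by (simp add: Let_def V_def[symmetric] j_def[symmetric])
qed simp_all

lemma sat_inst: "sat M f a (inst \<phi> i t) = sat M f (a(i := eval M f a t)) \<phi>"
  unfolding inst_def substitution
  by (intro arg_cong[of _ _ "\<lambda>a. sat M f a \<phi>"]) auto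

lemma eval_in:
  fixes t :: "('r,'f,'c) trm" and \<phi> :: "('r,'f,'c) fm"
  assumes "choice_structure T M f"
  shows "valuation M a \<Longrightarrow> wf_trm T t \<Longrightarrow> eval M f a t \<in> univ M"
   "\<phi> = \<phi>"
proof (induction t and \<phi>)
  case (Var x) then show ?case by (simp add: valuation_def)
next
  case (Const x) then show ?case using assms by (auto simp: choice_structure_def is_fo_struct_def)
next
  case (Fun h ts)
  then have "set (map (eval M f a) ts) \<subseteq> univ M" by auto
  then show ?case using assms Fun.prems by (auto simp: choice_structure_def is_fo_struct_def)
next
  case (Eps x1a x2a)
  then show ?case using assms by (auto simp: choice_structure_def choice_function_def)
qed simp_all

lemma choice_in:
  assumes "choice_structure T M f" "S \<subseteq> univ M"
  shows "f S \<in> univ M" "S \<noteq> {} \<Longrightarrow> f S \<in> S"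
  using assms by (simp_all add: choice_structure_def choice_function_def)

lemma sat_Forall:
  assumes is_model: "choice_structure T M f" and "valuation M a" "wf_fm T \<phi>"
  shows "sat M f a (Forall i \<phi>) \<longleftrightarrow> (\<forall>m\<in>univ M. sat M f (a(i:=m)) \<phi>)"
proof -
  define S where "S = {m \<in> univ M. \<not> sat M f (a(i := m)) \<phi>}"
  have "S \<subseteq> univ M" unfolding S_def by blast
  note S = choice_in[OF is_model this]
  have "sat M f a (Forall i \<phi>) \<longleftrightarrow> sat M f (a(i := f S)) \<phi>"
    by (simp add: Forall_def sat_inst S_def)
  also have "\<dots> \<longleftrightarrow> S = {}" using S unfolding S_def by blast
  finally show ?thesis unfolding S_def by blast
qed

lemma sound:
  assumes is_model: "choice_structure T M f" and "provable T \<Gamma> \<phi>"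
   and G: "\<forall>\<phi>\<in>\<Gamma>. sat M f a \<phi>" and a: "valuation M a"
  shows "sat M f a \<phi>"
  using assms(2)
proof induction
  case (taut \<phi>)
  show ?case using taut(2)[unfolded tautology_def, rule_format, of "sat M f a"] by simp
next
  case (eq_subst \<phi> s t i) show ?case by (cases "eval M f a s = eval M f a t") (simp_all add: Imp_def sat_inst)
next
  case (transfinity \<phi> t i)
  define S where "S = {m \<in> univ M. sat M f (a(i := m)) \<phi>}"
  have "S \<subseteq> univ M" unfolding S_def by blast
  note S = choice_in(2)[OF is_model this]
  have "eval M f a t \<in> univ M" using eval_in(1)[OF is_model a] transfinity by simp
  then have "sat M f (a(i := eval M f a t)) \<phi> \<Longrightarrow> sat M f (a(i := f S)) \<phi>"
    using S unfolding S_def by blast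
  then show ?case by (simp add: Imp_def sat_inst S_def)
next
  case (extensionality \<phi> \<psi> i)
  then have "wf_fm T (Iff \<phi> \<psi>)" by (simp add: Iff_def And_def Imp_def)
  from sat_Forall[OF is_model a this, of i] show ?case
    by (auto simp add: Imp_def Iff_def And_def intro!: arg_cong[of _ _ f])
qed (use G in \<open>auto simp: Imp_def\<close>)

lemma wf_subst:
  fixes t :: "('r,'f,'c) trm" and \<phi> :: "('r,'f,'c) fm"
  shows "(\<forall>k. wf_trm T (\<sigma> k)) \<Longrightarrow> wf_trm T t \<Longrightarrow> wf_trm T (subst_trm \<sigma> t)"
   "(\<forall>k. wf_trm T (\<sigma> k)) \<Longrightarrow> wf_fm T \<phi> \<Longrightarrow> wf_fm T (subst_fm \<sigma> \<phi>)"
  by (induction t and \<phi> arbitrary: \<sigma> and \<sigma>) (auto simp: Let_def)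

lemma fv_subst:
  fixes t :: "('r,'f,'c) trm" and \<phi> :: "('r,'f,'c) fm"
  shows "fv_trm (subst_trm \<sigma> t) = (\<Union>k\<in>fv_trm t. fv_trm (\<sigma> k))"
   "fv_fm (subst_fm \<sigma> \<phi>) = (\<Union>k\<in>fv_fm \<phi>. fv_trm (\<sigma> k))"
proof (induction t and \<phi> arbitrary: \<sigma> and \<sigma>)
  case (Eps i \<phi>)
  define V where "V = (\<Union>k\<in>fv_fm \<phi> - {i}. fv_trm (\<sigma> k))"
  define j where "j = fresh_binder i V"
  have jV: "j \<notin> V" unfolding j_def by (rule fresh_binder_notin) (simp add: V_def fv_finite)
  have "(\<Union>k\<in>fv_fm \<phi>. fv_trm ((\<sigma>(i := Var j)) k)) - {j} = V"
    using jV unfolding V_def by (auto split: if_splits)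
  then show ?case by (simp add: Let_def V_def[symmetric] j_def[symmetric] Eps.IH del: fun_upd_apply)
qed auto

locale choice_model =
  fixes T :: "('r, 'f, 'c) sim_type"
    and N :: "('r, 'f, 'c, 'm) fo_struct"
    and g :: "'m set \<Rightarrow> 'm"
  assumes is_model: "choice_structure T N g"
begin

abbreviation "\<Gamma> \<equiv> Th T N g"
abbreviation "val \<equiv> (\<lambda>t. eval N g (\<lambda>_. g {}) t)"

lemma valuation_const: "valuation N (\<lambda>_. g {})"
  using is_model by (auto simp: valuation_def choice_structure_def choice_function_def)

lemma prov: assumes "\<phi> \<in> sentences T" shows "provable T \<Gamma> \<phi> \<longleftrightarrow> sat N g (\<lambda>_. g {}) \<phi>"
proof
  show "provable T \<Gamma> \<phi> \<Longrightarrow> sat N g (\<lambda>_. g {}) \<phi>"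
    by (rule sound[OF is_model _ _ valuation_const, of \<Gamma>]) (auto simp: Th_def valuation_const)
  assume "sat N g (\<lambda>_. g {}) \<phi>"
  then have "\<forall>a. sat N g a \<phi>" using coincidence(2)[of \<phi>] assms unfolding sentences_def by blast
  then show "provable T \<Gamma> \<phi>" using assms by (auto intro!: provable.assm simp: Th_def)
qed

lemma Eps1_cl: "t \<in> Eps1 T \<Longrightarrow> wf_trm T t \<and> fv_trm t = {}"
  by (auto simp: Eps1_def Fm_def)

lemma prov_eq_iff: "(s,t) \<in> prov_eq T \<Gamma> \<longleftrightarrow> s \<in> Eps1 T \<and> t \<in> Eps1 T \<and> val s = val t"
  using prov[of "Eq s t"] Eps1_cl[of s] Eps1_cl[of t] by (auto simp: prov_eq_def sentences_def)

lemma equiv_pe: "equiv (Eps1 T) (prov_eq T \<Gamma>)"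
  by (rule equivI) (auto simp: refl_on_def sym_def trans_def prov_eq_iff)

lemma cls_iff: "s \<in> Eps1 T \<Longrightarrow> t \<in> Eps1 T \<Longrightarrow> cls T \<Gamma> s = cls T \<Gamma> t \<longleftrightarrow> val s = val t"
  unfolding cls_def using eq_equiv_class_iff[OF equiv_pe] prov_eq_iff by simp

definition eps_vals where "eps_vals = val ` Eps1 T"

lemma eps_vals_sub: "eps_vals \<subseteq> univ N" using eval_in(1)[OF is_model valuation_const] Eps1_cl unfolding eps_vals_def by auto

lemma FmI: "\<phi> \<in> Fm T i \<Longrightarrow> Eps i \<phi> \<in> Eps1 T" by (auto simp: Eps1_def)

lemma val_Eps: "val (Eps i \<phi>) = g {m\<in>univ N. sat N g ((\<lambda>_. g {})(i:=m)) \<phi>}" by simp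

lemma inst_sent: "\<phi> \<in> Fm T i \<Longrightarrow> t \<in> Eps1 T \<Longrightarrow> inst \<phi> i t \<in> sentences T"
  using Eps1_cl[of t] by (auto simp: sentences_def Fm_def inst_def fv_subst intro!: wf_subst split: if_splits)

lemma prov_inst: "\<phi> \<in> Fm T i \<Longrightarrow> t \<in> Eps1 T \<Longrightarrow>
   provable T \<Gamma> (inst \<phi> i t) \<longleftrightarrow> sat N g ((\<lambda>_. g {})(i:=val t)) \<phi>"
  using prov[OF inst_sent] by (simp add: sat_inst)

text \<open>
  Two definable sets that agree on the values of closed epsilon terms are equal: otherwise the
  closed term \<open>Eps 0 \<chi>\<close> below would denote an element on which they differ.
\<close>

lemma agree:
  assumes p: "\<phi> \<in> Fm T i" and q: "\<psi> \<in> Fm T j"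
   and e: "\<forall>m\<in>eps_vals. sat N g ((\<lambda>_. g {})(i:=m)) \<phi> = sat N g ((\<lambda>_. g {})(j:=m)) \<psi>"
  shows "\<forall>m\<in>univ N. sat N g ((\<lambda>_. g {})(i:=m)) \<phi> = sat N g ((\<lambda>_. g {})(j:=m)) \<psi>"
proof -
  let ?z = "\<lambda>_::nat. g {}"
  define \<chi> where "\<chi> = Neg (Iff (inst \<phi> i (Var 0)) (inst \<psi> j (Var 0)))"
  have ch: "\<chi> \<in> Fm T 0" using p q
    by (auto simp: \<chi>_def Fm_def Iff_def And_def Imp_def inst_def fv_subst intro!: wf_subst split: if_splits)
  have upd: "sat N g ((?z(0:=m))(i:=m)) \<phi> = sat N g (?z(i:=m)) \<phi>"
     "sat N g ((?z(0:=m))(j:=m)) \<psi> = sat N g (?z(j:=m)) \<psi>" for m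
    using p q by (auto intro!: coincidence(2) simp: Fm_def)
  have s: "sat N g (?z(0:=m)) \<chi> \<longleftrightarrow> sat N g (?z(i:=m)) \<phi> \<noteq> sat N g (?z(j:=m)) \<psi>" for m
    by (auto simp: \<chi>_def Iff_def And_def Imp_def sat_inst upd)
  let ?S = "{m\<in>univ N. sat N g (?z(0:=m)) \<chi>}"
  have "val (Eps 0 \<chi>) = g ?S" by (rule val_Eps)
  then have in_vals: "g ?S \<in> eps_vals" using FmI[OF ch] unfolding eps_vals_def by (metis imageI)
  have "?S \<subseteq> univ N" by blast
  note choice_in(2)[OF is_model this]
  moreover have "g ?S \<notin> ?S" if "g ?S \<in> eps_vals"
    using bspec[OF e that] s[of "g ?S"] by blast
  ultimately have "?S = {}" using in_vals by blast
  then show ?thesis using s by blast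
qed

definition val_of_cls where "val_of_cls x = (THE y. \<forall>t\<in>x. val t = y)"

lemma val_of_cls_cls:
  assumes "t \<in> Eps1 T"
  shows "val_of_cls (cls T \<Gamma> t) = val t"
proof -
  have "(\<forall>s\<in>cls T \<Gamma> t. val s = y) \<longleftrightarrow> val t = y" for y
    using assms unfolding cls_def Image_singleton_iff Ball_def prov_eq_iff by metis
  then show ?thesis unfolding val_of_cls_def by simp
qed

lemma univ_iff: "x \<in> Eps1 T // prov_eq T \<Gamma> \<longleftrightarrow> (\<exists>t\<in>Eps1 T. x = cls T \<Gamma> t)"
  by (auto simp: quotient_def cls_def)

definition cls_of_val where "cls_of_val y = cls T \<Gamma> (SOME t. t \<in> Eps1 T \<and> val t = y)"

lemma cls_of_val_val: "t \<in> Eps1 T \<Longrightarrow> cls_of_val (val t) = cls T \<Gamma> t"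
  unfolding cls_of_val_def using someI[of "\<lambda>s. s \<in> Eps1 T \<and> val s = val t" t] cls_iff by blast

definition can_univ where "can_univ = Eps1 T // prov_eq T \<Gamma>"
definition can_struct where "can_struct = \<lparr>univ = can_univ,
   rel_int = (\<lambda>r. {xs. length xs = rel_ar T r \<and> set xs \<subseteq> can_univ \<and> map val_of_cls xs \<in> rel_int N r}),
   fun_int = (\<lambda>h xs. cls_of_val (fun_int N h (map val_of_cls xs))), const_int = (\<lambda>c. cls_of_val (const_int N c))\<rparr>"

definition def_set where "def_set i \<phi> = {cls T \<Gamma> t | t. t \<in> Eps1 T \<and> provable T \<Gamma> (inst \<phi> i t)}"

definition can_choice where "can_choice S = (if \<exists>i. \<exists>\<phi>\<in>Fm T i. S = def_set i \<phi>
   then (THE x. \<exists>i. \<exists>\<phi>\<in>Fm T i. S = def_set i \<phi> \<and> x = cls T \<Gamma> (Eps i \<phi>))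
   else if S = {} then (SOME x. x \<in> can_univ) else (SOME x. x\<in>S))"

lemma in_def_set: "\<phi> \<in> Fm T i \<Longrightarrow> t \<in> Eps1 T \<Longrightarrow> cls T \<Gamma> t \<in> def_set i \<phi> \<longleftrightarrow> sat N g ((\<lambda>_. g {})(i:=val t)) \<phi>"
  unfolding def_set_def using prov_inst cls_iff by (smt (verit) mem_Collect_eq)

lemma def_set_eq: assumes p: "\<phi> \<in> Fm T i" and q: "\<psi> \<in> Fm T j" and "def_set i \<phi> = def_set j \<psi>"
  shows "val (Eps i \<phi>) = val (Eps j \<psi>)"
proof -
  have "\<forall>m\<in>eps_vals. sat N g ((\<lambda>_. g {})(i:=m)) \<phi> = sat N g ((\<lambda>_. g {})(j:=m)) \<psi>"
    using in_def_set[OF p] in_def_set[OF q] assms(3) unfolding eps_vals_def by auto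
  from agree[OF p q this] show ?thesis unfolding val_Eps by (metis (mono_tags, lifting))
qed

lemma can_choice_def_set: assumes p: "\<phi> \<in> Fm T i" shows "can_choice (def_set i \<phi>) = cls T \<Gamma> (Eps i \<phi>)"
proof -
  have "(THE x. \<exists>j. \<exists>\<psi>\<in>Fm T j. def_set i \<phi> = def_set j \<psi> \<and> x = cls T \<Gamma> (Eps j \<psi>)) = cls T \<Gamma> (Eps i \<phi>)"
  proof (rule the_equality)
    show "\<exists>j. \<exists>\<psi>\<in>Fm T j. def_set i \<phi> = def_set j \<psi> \<and> cls T \<Gamma> (Eps i \<phi>) = cls T \<Gamma> (Eps j \<psi>)" using p by blast
  next
    fix x assume "\<exists>j. \<exists>\<psi>\<in>Fm T j. def_set i \<phi> = def_set j \<psi> \<and> x = cls T \<Gamma> (Eps j \<psi>)"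
    then obtain j \<psi> where q: "\<psi>\<in>Fm T j" and e: "def_set i \<phi> = def_set j \<psi>" and x: "x = cls T \<Gamma> (Eps j \<psi>)" by blast
    show "x = cls T \<Gamma> (Eps i \<phi>)" using def_set_eq[OF p q e] cls_iff[OF FmI[OF p] FmI[OF q]] x by simp
  qed
  moreover have "\<exists>j. \<exists>\<psi>\<in>Fm T j. def_set i \<phi> = def_set j \<psi>" using p by blast
  ultimately show ?thesis unfolding can_choice_def by (simp only: if_True)
qed

lemma can_univ_ne: "can_univ \<noteq> {}"
proof -
  have "Eq (Var 0) (Var 0) \<in> Fm T 0" by (simp add: Fm_def)
  from FmI[OF this] show ?thesis unfolding can_univ_def using univ_iff by blast
qed

lemma can_choice_function: "choice_function can_univ can_choice"
  unfolding choice_function_def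
proof (rule allI, rule impI)
  fix S assume S: "S \<subseteq> can_univ"
  have "can_choice S \<in> can_univ \<and> (S \<noteq> {} \<longrightarrow> can_choice S \<in> S)"
  proof (cases "\<exists>i. \<exists>\<phi>\<in>Fm T i. S = def_set i \<phi>")
    case False
    then have "can_choice S = (if S = {} then (SOME x. x \<in> can_univ) else (SOME x. x \<in> S))"
      unfolding can_choice_def by (simp only: if_False)
    then show ?thesis using S can_univ_ne some_in_eq[of S] some_in_eq[of can_univ] by auto
  next
    case True
    then obtain i \<phi> where p: "\<phi> \<in> Fm T i" and e: "S = def_set i \<phi>" by blast
    let ?S = "{m\<in>univ N. sat N g ((\<lambda>_. g {})(i:=m)) \<phi>}"
    have 1: "can_choice S = cls T \<Gamma> (Eps i \<phi>)" using can_choice_def_set[OF p] e by simp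
    have 2: "?S \<noteq> {} \<Longrightarrow> g ?S \<in> ?S" by (rule choice_in(2)[OF is_model]) blast+
    have "S \<noteq> {} \<Longrightarrow> ?S \<noteq> {}"
    proof -
      assume "S \<noteq> {}"
      then obtain t where t: "t \<in> Eps1 T" "cls T \<Gamma> t \<in> def_set i \<phi>" unfolding e def_set_def by blast
      then show ?thesis using in_def_set[OF p t(1)] eps_vals_sub unfolding eps_vals_def by auto
    qed
    then have "S \<noteq> {} \<Longrightarrow> can_choice S \<in> S" using 1 2 in_def_set[OF p FmI[OF p]] e by auto
    moreover have "can_choice S \<in> can_univ" using 1 FmI[OF p] univ_iff can_univ_def by auto
    ultimately show ?thesis by blast
  qed
  then show "can_choice S \<in> can_univ \<and> (S \<noteq> {} \<longrightarrow> can_choice S \<in> S)" .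
qed

lemma val_eps_eq:
  assumes "wf_trm T t" "fv_trm t = {}"
  shows "Eps 0 (Eq (Var 0) t) \<in> Eps1 T" "val (Eps 0 (Eq (Var 0) t)) = val t"
proof -
  show "Eps 0 (Eq (Var 0) t) \<in> Eps1 T" using assms by (auto intro!: FmI simp: Fm_def)
  define w where "w = val t"
  have ev: "eval N g a t = w" for a unfolding w_def by (rule coincidence(1)) (simp add: assms)
  have w: "w \<in> univ N" unfolding w_def by (rule eval_in(1)[OF is_model valuation_const assms(1)])
  have "{m \<in> univ N. sat N g ((\<lambda>_. g {})(0 := m)) (Eq (Var 0) t)} = {w}"
    using w by (auto simp: ev)
  moreover have "g {w} \<in> {w}" using choice_in(2)[OF is_model, of "{w}"] w by blast
  ultimately show "val (Eps 0 (Eq (Var 0) t)) = val t"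
    unfolding val_Eps w_def[symmetric] by simp
qed

lemma map_val_of_cls: "set as \<subseteq> Eps1 T \<Longrightarrow> map val_of_cls (map (cls T \<Gamma>) as) = map val as"
  using val_of_cls_cls by auto

lemma can_univ_list: "set xs \<subseteq> can_univ \<Longrightarrow> \<exists>as. set as \<subseteq> Eps1 T \<and> xs = map (cls T \<Gamma>) as"
proof (induction xs)
  case (Cons x xs)
  then obtain as t where "set as \<subseteq> Eps1 T" "xs = map (cls T \<Gamma>) as" "t \<in> Eps1 T" "x = cls T \<Gamma> t"
    using univ_iff can_univ_def by auto
  then show ?case by (intro exI[of _ "t # as"]) auto
qed simp

lemma fun_cl: assumes "h \<in> fun_syms T" "length as = fun_ar T h" "set as \<subseteq> Eps1 T"
  shows "wf_trm T (Fun h as)" "fv_trm (Fun h as) = {}"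
  using assms Eps1_cl by auto

lemma fun_int_can_struct: assumes "h \<in> fun_syms T" "length as = fun_ar T h" "set as \<subseteq> Eps1 T"
  shows "fun_int can_struct h (map (cls T \<Gamma>) as) = cls T \<Gamma> (Eps 0 (Eq (Var 0) (Fun h as)))"
  using val_eps_eq[OF fun_cl[OF assms]] cls_of_val_val[of "Eps 0 (Eq (Var 0) (Fun h as))"] map_val_of_cls[OF assms(3)]
  unfolding can_struct_def by (simp del: map_map)

lemma const_int_can_struct: assumes "c \<in> const_syms T"
  shows "const_int can_struct c = cls T \<Gamma> (Eps 0 (Eq (Var 0) (Const c)))"
  using val_eps_eq[of "Const c"] cls_of_val_val[of "Eps 0 (Eq (Var 0) (Const c))"] assms
  unfolding can_struct_def by simp

lemma canonical_model_can_struct: "canonical_model T \<Gamma> can_struct can_choice"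
  unfolding canonical_model_def
proof (intro conjI ballI allI impI)
  show "choice_structure T can_struct can_choice"
    unfolding choice_structure_def is_fo_struct_def
  proof (intro conjI ballI allI impI)
    show "univ can_struct \<noteq> {}" using can_univ_ne by (simp add: can_struct_def)
    show "choice_function (univ can_struct) can_choice" using can_choice_function by (simp add: can_struct_def)
    fix r show "rel_int can_struct r \<subseteq> {xs. length xs = rel_ar T r \<and> set xs \<subseteq> univ can_struct}" by (auto simp: can_struct_def)
  next
    fix h xs assume h: "h \<in> fun_syms T" "length xs = fun_ar T h \<and> set xs \<subseteq> univ can_struct"
    then obtain as where as: "set as \<subseteq> Eps1 T" "xs = map (cls T \<Gamma>) as" using can_univ_list by (auto simp: can_struct_def)
    then have "fun_int can_struct h xs = cls T \<Gamma> (Eps 0 (Eq (Var 0) (Fun h as)))"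
      using fun_int_can_struct[of h as] h by simp
    moreover have "Eps 0 (Eq (Var 0) (Fun h as)) \<in> Eps1 T" using val_eps_eq(1)[OF fun_cl] h as by simp
    ultimately show "fun_int can_struct h xs \<in> univ can_struct" using univ_iff by (auto simp: can_struct_def can_univ_def)
  next
    fix c assume "c \<in> const_syms T"
    then show "const_int can_struct c \<in> univ can_struct" using const_int_can_struct val_eps_eq(1)[of "Const c"] univ_iff
      by (auto simp: can_struct_def can_univ_def)
  qed
next
  show "univ can_struct = Eps1 T // prov_eq T \<Gamma>" by (simp add: can_struct_def can_univ_def)
next
  fix r as assume r: "r \<in> rel_syms T" and as: "length as = rel_ar T r \<and> set as \<subseteq> Eps1 T"
  have "Rel r as \<in> sentences T" using r as Eps1_cl by (auto simp: sentences_def)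
  from prov[OF this] have "provable T \<Gamma> (Rel r as) \<longleftrightarrow> map val as \<in> rel_int N r" by simp
  moreover have "set (map (cls T \<Gamma>) as) \<subseteq> can_univ" using as univ_iff can_univ_def by auto
  ultimately show "(map (cls T \<Gamma>) as \<in> rel_int can_struct r) = provable T \<Gamma> (Rel r as)"
    using map_val_of_cls[of as] as by (simp add: can_struct_def del: map_map)
qed (use fun_int_can_struct const_int_can_struct can_choice_def_set def_set_def in auto)

end

theorem canonical_model_exists:
  assumes "choice_structure T N g"
  shows "\<exists>M f. canonical_model T (Th T N g) M f"
proof -
  interpret choice_model T N g by unfold_locales (rule assms)
  show ?thesis using canonical_model_can_struct by blast
qed

end

theory Submission
  imports Defs
begin

text \<open>
  Every element of the canonical model of \<open>Th T N g\<close> is the class of a closed epsilon term, and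
  two such terms are in the same class iff they have the same value in \<open>(N, g)\<close>. Hence sending a
  class to the common value of its members (\<open>val_of_cls\<close>) is a well-defined injection.

  It preserves the values of all terms and the truth of all formulae, by simultaneous induction
  (\<open>val_of_cls_elementary\<close>). The only case that is not bookkeeping is \<open>Eps i \<phi>\<close> with parameters
  from the canonical model: each parameter is named by a closed epsilon term, and substituting
  these names in \<open>\<phi>\<close> gives a formula \<open>\<phi>'\<close> in which at most \<open>v\<^sub>i\<close> is free. By the induction
  hypothesis, the set defined by \<open>\<phi>\<close> in the canonical model is the one on which the
  choice function is prescribed to be the class of \<open>Eps i \<phi>'\<close>; and the value of \<open>Eps i \<phi>'\<close> in
  \<open>(N, g)\<close> is the choice from the set that \<open>\<phi>\<close> defines there.

  Applied to a closed term \<open>Eps i \<phi>\<close>, this shows that it denotes its own class in the canonical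
  model, so \<open>val_of_cls\<close> agrees with the canonical injection.
\<close>

section \<open>The canonical model in terms of values in the given structure\<close>

lemma closed_val_eq:
  assumes "fv_trm t = {}" "valuation M a"
  shows "closed_val M f t = eval M f a t"
  unfolding closed_val_def
proof (rule the_equality)
  show "\<forall>b. valuation M b \<longrightarrow> eval M f b t = eval M f a t"
    using assms by (auto intro: coincidence(1))
qed (use assms in blast)

text \<open>
  A choice structure \<open>(N, g)\<close> together with an arbitrary canonical model \<open>(Can, f)\<close> of its theory.
  As \<open>f\<close> is only prescribed on the sets \<open>def_set i \<phi>\<close>, this need not be the model
  \<open>(can_struct, can_choice)\<close>; it has the same universe.
\<close>

locale canonical_setting = choice_model T N g
  for T :: "('r, 'f, 'c) sim_type"
    and N :: "('r, 'f, 'c, 'm) fo_struct"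
    and g :: "'m set \<Rightarrow> 'm" +
  fixes Can :: "('r, 'f, 'c, ('r, 'f, 'c) trm set) fo_struct"
    and f :: "('r, 'f, 'c) trm set set \<Rightarrow> ('r, 'f, 'c) trm set"
  assumes canonical: "canonical_model T \<Gamma> Can f"
begin

lemma Can_is_model: "choice_structure T Can f"
  using canonical by (simp add: canonical_model_def)

lemma univ_Can: "univ Can = can_univ"
  using canonical by (simp add: canonical_model_def can_univ_def)

lemma univ_Can_iff: "x \<in> univ Can \<longleftrightarrow> (\<exists>t\<in>Eps1 T. x = cls T \<Gamma> t)"
  by (simp add: univ_Can can_univ_def univ_iff)

lemma univ_CanE:
  assumes "x \<in> univ Can"
  obtains t where "t \<in> Eps1 T" "x = cls T \<Gamma> t"
  using assms unfolding univ_Can_iff by blast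

lemma val_of_cls_in_univ: "x \<in> univ Can \<Longrightarrow> val_of_cls x \<in> univ N"
  using univ_Can_iff val_of_cls_cls eps_vals_sub unfolding eps_vals_def by auto

lemma inj_on_val_of_cls: "inj_on val_of_cls (univ Can)"
proof (rule inj_onI)
  fix x y
  assume xy: "x \<in> univ Can" "y \<in> univ Can" and eq: "val_of_cls x = val_of_cls y"
  obtain s where s: "s \<in> Eps1 T" "x = cls T \<Gamma> s"
    using xy(1) by (rule univ_CanE)
  obtain t where t: "t \<in> Eps1 T" "y = cls T \<Gamma> t"
    using xy(2) by (rule univ_CanE)
  show "x = y"
    using eq cls_iff[OF s(1) t(1)] val_of_cls_cls s t by simp
qed

lemma rel_int_Can:
  assumes "r \<in> rel_syms T" "length xs = rel_ar T r" "set xs \<subseteq> univ Can"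
  shows "xs \<in> rel_int Can r \<longleftrightarrow> map val_of_cls xs \<in> rel_int N r"
proof -
  obtain as where as: "set as \<subseteq> Eps1 T" "xs = map (cls T \<Gamma>) as"
    using can_univ_list assms(3) univ_Can by auto
  then have "xs \<in> rel_int Can r \<longleftrightarrow> provable T \<Gamma> (Rel r as)"
    using canonical assms(1,2) by (simp add: canonical_model_def)
  also have "Rel r as \<in> sentences T"
    using assms as Eps1_cl by (auto simp: sentences_def)
  then have "provable T \<Gamma> (Rel r as) \<longleftrightarrow> map val as \<in> rel_int N r"
    using prov by simp
  also have "map val as = map val_of_cls xs"
    using map_val_of_cls[OF as(1)] as(2) by (simp del: map_map map_eq_conv)
  finally show ?thesis .
qed

lemma fun_int_Can:
  assumes "h \<in> fun_syms T" "length xs = fun_ar T h" "set xs \<subseteq> univ Can"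
  shows "val_of_cls (fun_int Can h xs) = fun_int N h (map val_of_cls xs)"
proof -
  obtain as where as: "set as \<subseteq> Eps1 T" "xs = map (cls T \<Gamma>) as"
    using can_univ_list assms(3) univ_Can by auto
  have len: "length as = fun_ar T h"
    using as(2) assms(2) by simp
  have "fun_int Can h xs = cls T \<Gamma> (Eps 0 (Eq (Var 0) (Fun h as)))"
    using canonical assms(1) as len by (simp add: canonical_model_def)
  then have "val_of_cls (fun_int Can h xs) = val (Fun h as)"
    using val_eps_eq[OF fun_cl[OF assms(1) len as(1)]] by (metis val_of_cls_cls)
  then show ?thesis
    using map_val_of_cls[OF as(1)] as(2) by (simp del: map_map map_eq_conv)
qed

lemma const_int_Can:
  assumes "c \<in> const_syms T"
  shows "val_of_cls (const_int Can c) = const_int N c"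
proof -
  have "const_int Can c = cls T \<Gamma> (Eps 0 (Eq (Var 0) (Const c)))"
    using canonical assms by (simp add: canonical_model_def)
  moreover have "wf_trm T (Const c)" "fv_trm (Const c) = {}"
    using assms by auto
  ultimately show ?thesis
    using val_eps_eq[of "Const c"] by (metis val_of_cls_cls eval.simps(2))
qed

lemma choice_Can:
  "\<phi> \<in> Fm T i \<Longrightarrow> f (def_set i \<phi>) = cls T \<Gamma> (Eps i \<phi>)"
  using canonical unfolding canonical_model_def def_set_def by blast

section \<open>Preservation of values and truth\<close>

text \<open>
  Naming the parameters of \<open>\<phi>\<close> by closed epsilon terms \<open>\<tau> k\<close>, one gets a formula in at most \<open>v\<^sub>i\<close>
  that defines the same set.
\<close>

lemma name_parameters:
  fixes i :: nat
  assumes \<tau>: "\<forall>k. \<tau> k \<in> Eps1 T" and wf: "wf_fm T \<phi>"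
  defines "\<phi>' \<equiv> subst_fm (\<tau>(i := Var i)) \<phi>"
  shows "\<phi>' \<in> Fm T i"
    and "sat N g ((\<lambda>_. g {})(i := m)) \<phi>' \<longleftrightarrow> sat N g ((\<lambda>k. val (\<tau> k))(i := m)) \<phi>"
proof -
  have closed: "fv_trm (\<tau> k) = {}" and "wf_trm T (\<tau> k)" for k
    using \<tau> Eps1_cl by blast+
  then show "\<phi>' \<in> Fm T i"
    using wf unfolding \<phi>'_def Fm_def by (auto simp: fv_subst intro!: wf_subst split: if_splits)
  have "eval N g ((\<lambda>_. g {})(i := m)) (\<tau> k) = val (\<tau> k)" for k
    by (rule coincidence(1)) (simp add: closed)
  then have "(\<lambda>k. eval N g ((\<lambda>_. g {})(i := m)) ((\<tau>(i := Var i)) k)) = (\<lambda>k. val (\<tau> k))(i := m)"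
    by auto
  then show "sat N g ((\<lambda>_. g {})(i := m)) \<phi>' \<longleftrightarrow> sat N g ((\<lambda>k. val (\<tau> k))(i := m)) \<phi>"
    unfolding \<phi>'_def substitution by (rule arg_cong)
qed

lemma val_of_cls_elementary:
  shows "valuation Can a \<Longrightarrow> wf_trm T t \<Longrightarrow>
      val_of_cls (eval Can f a t) = eval N g (\<lambda>k. val_of_cls (a k)) t"
    and "valuation Can a \<Longrightarrow> wf_fm T \<phi> \<Longrightarrow>
      sat Can f a \<phi> \<longleftrightarrow> sat N g (\<lambda>k. val_of_cls (a k)) \<phi>"
proof (induction t and \<phi> arbitrary: a and a)
  case (Const c)
  then show ?case using const_int_Can by simp
next
  case (Fun h ts)
  let ?xs = "map (eval Can f a) ts"
  have "set ?xs \<subseteq> univ Can"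
    using Fun.prems eval_in(1)[OF Can_is_model] by auto
  then have "val_of_cls (fun_int Can h ?xs) = fun_int N h (map val_of_cls ?xs)"
    using Fun.prems by (intro fun_int_Can) auto
  also have "map val_of_cls ?xs = map (eval N g (\<lambda>k. val_of_cls (a k))) ts"
    using Fun.IH Fun.prems by auto
  finally show ?case by simp
next
  case (Eps i \<phi>)
  have "\<forall>k. \<exists>t. t \<in> Eps1 T \<and> a k = cls T \<Gamma> t"
    using Eps.prems(1) unfolding valuation_def univ_Can_iff by blast
  then obtain \<tau> where \<tau>: "\<forall>k. \<tau> k \<in> Eps1 T" "\<forall>k. a k = cls T \<Gamma> (\<tau> k)"
    by metis
  define \<phi>' where "\<phi>' = subst_fm (\<tau>(i := Var i)) \<phi>"
  have wf: "wf_fm T \<phi>"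
    using Eps.prems by simp
  have Fm: "\<phi>' \<in> Fm T i"
    unfolding \<phi>'_def by (rule name_parameters(1)[OF \<tau>(1) wf])
  have a: "(\<lambda>k. val_of_cls (a k)) = (\<lambda>k. val (\<tau> k))"
    using \<tau> val_of_cls_cls by auto
  have sat': "sat N g ((\<lambda>_. g {})(i := m)) \<phi>' \<longleftrightarrow> sat N g ((\<lambda>k. val_of_cls (a k))(i := m)) \<phi>" for m
    unfolding a \<phi>'_def by (rule name_parameters(2)[OF \<tau>(1) wf])
  have IH: "sat Can f (a(i := x)) \<phi> \<longleftrightarrow> sat N g ((\<lambda>k. val_of_cls (a k))(i := val_of_cls x)) \<phi>"
    if "x \<in> univ Can" for x
  proof -
    have "valuation Can (a(i := x))"
      using that Eps.prems(1) by (simp add: valuation_def)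
    moreover have upd: "(\<lambda>k. val_of_cls ((a(i := x)) k)) = (\<lambda>k. val_of_cls (a k))(i := val_of_cls x)"
      by auto
    ultimately show ?thesis
      using Eps.IH[of "a(i := x)"] wf by (simp add: upd del: fun_upd_apply)
  qed
  \<comment> \<open>The set from which \<open>f\<close> chooses is one of those on which its value is prescribed.\<close>
  have "x \<in> univ Can \<and> sat Can f (a(i := x)) \<phi> \<longleftrightarrow> x \<in> def_set i \<phi>'" for x
  proof (cases "x \<in> univ Can")
    case True
    then obtain t where "t \<in> Eps1 T" "x = cls T \<Gamma> t"
      by (rule univ_CanE)
    then show ?thesis
      using IH[OF True] True in_def_set[OF Fm] sat' val_of_cls_cls by simp
  next
    case False
    then show ?thesis
      using univ_Can_iff unfolding def_set_def by auto
  qed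
  then have "{x \<in> univ Can. sat Can f (a(i := x)) \<phi>} = def_set i \<phi>'"
    by blast
  then have "eval Can f a (Eps i \<phi>) = cls T \<Gamma> (Eps i \<phi>')"
    using choice_Can[OF Fm] by simp
  then have "val_of_cls (eval Can f a (Eps i \<phi>)) = val (Eps i \<phi>')"
    using val_of_cls_cls[OF FmI[OF Fm]] by simp
  then show ?case
    by (simp add: sat')
next
  case (Eq s t)
  then have "eval Can f a s \<in> univ Can" "eval Can f a t \<in> univ Can"
    using eval_in(1)[OF Can_is_model] by auto
  from inj_on_eq_iff[OF inj_on_val_of_cls this] show ?case
    using Eq.IH[OF Eq.prems(1)] Eq.prems(2) by simp
next
  case (Rel r ts)
  let ?xs = "map (eval Can f a) ts"
  have "set ?xs \<subseteq> univ Can"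
    using Rel.prems eval_in(1)[OF Can_is_model] by auto
  then have "?xs \<in> rel_int Can r \<longleftrightarrow> map val_of_cls ?xs \<in> rel_int N r"
    using Rel.prems by (intro rel_int_Can) auto
  also have "map val_of_cls ?xs = map (eval N g (\<lambda>k. val_of_cls (a k))) ts"
    using Rel.IH Rel.prems by auto
  finally show ?case by simp
qed auto

section \<open>The canonical injection\<close>

lemma ex_valuation_Can: "\<exists>a. valuation Can a"
proof -
  obtain x where "x \<in> univ Can"
    using can_univ_ne univ_Can by blast
  then have "valuation Can (\<lambda>_. x)"
    by (simp add: valuation_def)
  then show ?thesis
    by blast
qed

lemma closed_val_N: "t \<in> Eps1 T \<Longrightarrow> closed_val N g t = val t"
  using closed_val_eq[OF _ valuation_const] Eps1_cl by blast

text \<open>A closed epsilon term denotes its own class in the canonical model.\<close>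

lemma closed_val_Can:
  assumes "t \<in> Eps1 T"
  shows "closed_val Can f t = cls T \<Gamma> t"
proof -
  obtain a where a: "valuation Can a"
    using ex_valuation_Can by blast
  have t: "wf_trm T t" "fv_trm t = {}"
    using assms Eps1_cl by auto
  have "val_of_cls (eval Can f a t) = eval N g (\<lambda>k. val_of_cls (a k)) t"
    by (rule val_of_cls_elementary(1)[OF a t(1)])
  also have "\<dots> = val t"
    by (rule coincidence(1)) (simp add: t)
  also have "\<dots> = val_of_cls (cls T \<Gamma> t)"
    using val_of_cls_cls[OF assms] by simp
  finally have "eval Can f a t = cls T \<Gamma> t"
    by (rule inj_onD[OF inj_on_val_of_cls])
      (use assms univ_Can_iff eval_in(1)[OF Can_is_model a t(1)] in auto)
  then show ?thesis
    using closed_val_eq[OF t(2) a] by metis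
qed

lemma canonical_injection_cls:
  assumes "t \<in> Eps1 T"
  shows "canonical_injection T Can f N g (cls T \<Gamma> t) = val t"
proof -
  have "(\<exists>i. \<exists>\<phi>\<in>Fm T i. cls T \<Gamma> t = closed_val Can f (Eps i \<phi>) \<and> y = closed_val N g (Eps i \<phi>))
      \<longleftrightarrow> (\<exists>s\<in>Eps1 T. cls T \<Gamma> t = closed_val Can f s \<and> y = closed_val N g s)" for y
    unfolding Eps1_def by blast
  moreover have "(\<exists>s\<in>Eps1 T. cls T \<Gamma> t = closed_val Can f s \<and> y = closed_val N g s)
      \<longleftrightarrow> y = val t" for y
    using assms closed_val_Can closed_val_N cls_iff[OF assms] by auto
  ultimately show ?thesis
    unfolding canonical_injection_def by simp
qed

lemma canonical_injection_eq_val_of_cls: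
  "x \<in> univ Can \<Longrightarrow> canonical_injection T Can f N g x = val_of_cls x"
  using univ_Can_iff canonical_injection_cls val_of_cls_cls by auto

lemma canonical_injection_elementary:
  "elementary_embedding T Can f N g (canonical_injection T Can f N g)"
proof -
  let ?\<eta> = "canonical_injection T Can f N g"
  have "?\<eta> ` univ Can \<subseteq> univ N"
    using canonical_injection_eq_val_of_cls val_of_cls_in_univ by auto
  moreover have "inj_on ?\<eta> (univ Can)"
    using inj_on_val_of_cls by (simp add: canonical_injection_eq_val_of_cls cong: inj_on_cong)
  moreover have "?\<eta> \<circ> a = val_of_cls \<circ> a" if "valuation Can a" for a
    using that canonical_injection_eq_val_of_cls by (auto simp: valuation_def)
  ultimately show ?thesis
    using val_of_cls_elementary(2) unfolding elementary_embedding_def by (simp add: comp_def)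
qed

end

theorem proposition3:
  fixes T :: "('r, 'f, 'c) sim_type"
    and N :: "('r, 'f, 'c, 'm) fo_struct"
    and g :: "'m set \<Rightarrow> 'm"
    and Can :: "('r, 'f, 'c, ('r, 'f, 'c) trm set) fo_struct"
    and f :: "('r, 'f, 'c) trm set set \<Rightarrow> ('r, 'f, 'c) trm set"
  assumes "choice_structure T N g"
    and "canonical_model T (Th T N g) Can f"
  shows "let \<eta> = canonical_injection T Can f N g in
    (\<forall>i. \<forall>\<phi>\<in>Fm T i. \<eta> (closed_val Can f (Eps i \<phi>)) = closed_val N g (Eps i \<phi>)) \<and>
    elementary_embedding T Can f N g \<eta>"
proof -
  interpret canonical_setting T N g Can f
    by unfold_locales (use assms in auto)
  show ?thesis
    using canonical_injection_elementary
    by (simp add: Let_def canonical_injection_cls closed_val_Can closed_val_N FmI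
        del: eval.simps)
qed

end
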